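(* Let $\Theta=(\Sigma,\mathit{sim},\mathit{ser})$ be a comtrace alphabet, let $\leq$ be a total order on $\Sigma$, and let $\tau$ be a comtrace over $\Theta$. Then the step sequence of $\tau$ in Foata canonical form is the $\widehat{\leq}$-greatest step sequence contained in $\tau$, and the lexicographical canonical form $minlex(\tau)$ is the $\widehat{\leq}$-least step sequence contained in $\tau$.
   Context: A comtrace alphabet is a triple $\Theta=(\Sigma,\mathit{sim},\mathit{ser})$ where $\Sigma$ is a finite nonempty alphabet and $\mathit{ser}\subseteq\mathit{sim}\subseteq\Sigma\times\Sigma$, with $\mathit{sim}$ irreflexive and symmetric. The step alphabet $\mathbb{S}$ is the set of nonempty $A\subseteq\Sigma$ with $(a,b)\in\mathit{sim}$ for all distinct $a,b\in A$. Step sequences are finite (possibly empty) sequences of steps. The comtrace congruence $\equiv_\Theta$ is the reflexive, symmetric and transitive closure of the relation $\sim_\Theta$ where $uABz\sim_\Theta u(A\cup B)z$ whenever $u,z$ are step sequences, $A,B\in\mathbb{S}$ and $A\times B\subseteq\mathit{ser}$. Comtraces are the equivalence classes $[w]$ of $\equiv_\Theta$. A step sequence $A_1\ldots A_n$ is in Foata canonical form if for each $i\le n$, whenever $Av\equiv_\Theta A_i\ldots A_n$ for some $A\in\mathbb{S}$ and step sequence $v$, then $A\subseteq A_i$; each comtrace contains exactly one such step sequence. The order $\widehat{\leq}$ on steps: $A\widehat{\leq}B$ if $|A|<|B|$, or $|A|=|B|$ and either $A=B$ or $\min(A\setminus B)\leq\min(B\setminus A)$ (minimum w.r.t. $\leq$).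 It is extended lexicographically to step sequences: compare at the first position where they differ, and a proper prefix is smaller. $minlex(\tau)$, the lexicographical canonical form, is the $\widehat{\leq}$-least step sequence in $\tau$. *)

theory Defs
  imports Main
begin

locale comtrace_alphabet =
  fixes \<Sigma> :: "'a set" and sim ser :: "'a rel"
  assumes finite_alphabet: "finite \<Sigma>"
    and nonempty_alphabet: "\<Sigma> \<noteq> {}"
    and ser_sub_sim: "ser \<subseteq> sim"
    and sim_sub: "sim \<subseteq> \<Sigma> \<times> \<Sigma>"
    and irrefl_sim: "irrefl sim"
    and sym_sim: "sym sim"

definition steps :: "'a set \<Rightarrow> 'a rel \<Rightarrow> 'a set set" where
  "steps \<Sigma> sim = {A. A \<noteq> {} \<and> A \<subseteq> \<Sigma> \<and> (\<forall>a\<in>A. \<forall>b\<in>A. a \<noteq> b \<longrightarrow> (a, b) \<in> sim)}"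

abbreviation step_seqs :: "'a set \<Rightarrow> 'a rel \<Rightarrow> 'a set list set" where
  "step_seqs \<Sigma> sim \<equiv> lists (steps \<Sigma> sim)"

definition comtrace_rel :: "'a set \<Rightarrow> 'a rel \<Rightarrow> 'a rel \<Rightarrow> 'a set list rel" where
  "comtrace_rel \<Sigma> sim ser =
     {(u @ [A, B] @ z, u @ [A \<union> B] @ z) | u A B z.
        u \<in> step_seqs \<Sigma> sim \<and> z \<in> step_seqs \<Sigma> sim \<and>
        A \<in> steps \<Sigma> sim \<and> B \<in> steps \<Sigma> sim \<and> A \<times> B \<subseteq> ser}"

text \<open>The intersection restricts reflexivity of the closure to step sequences.\<close>

definition comtrace_cong :: "'a set \<Rightarrow> 'a rel \<Rightarrow> 'a rel \<Rightarrow> 'a set list rel" where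
  "comtrace_cong \<Sigma> sim ser =
     (comtrace_rel \<Sigma> sim ser \<union> (comtrace_rel \<Sigma> sim ser)\<inverse>)\<^sup>*
       \<inter> (step_seqs \<Sigma> sim \<times> step_seqs \<Sigma> sim)"

definition comtraces :: "'a set \<Rightarrow> 'a rel \<Rightarrow> 'a rel \<Rightarrow> 'a set list set set" where
  "comtraces \<Sigma> sim ser = step_seqs \<Sigma> sim // comtrace_cong \<Sigma> sim ser"

definition is_foata :: "'a set \<Rightarrow> 'a rel \<Rightarrow> 'a rel \<Rightarrow> 'a set list \<Rightarrow> bool" where
  "is_foata \<Sigma> sim ser w \<longleftrightarrow>
     w \<in> step_seqs \<Sigma> sim \<and>
     (\<forall>i < length w. \<forall>A \<in> steps \<Sigma> sim. \<forall>v \<in> step_seqs \<Sigma> sim.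
        (A # v, drop i w) \<in> comtrace_cong \<Sigma> sim ser \<longrightarrow> A \<subseteq> w ! i)"

definition foata_form :: "'a set \<Rightarrow> 'a rel \<Rightarrow> 'a rel \<Rightarrow> 'a set list set \<Rightarrow> 'a set list" where
  "foata_form \<Sigma> sim ser \<tau> = (THE w. w \<in> \<tau> \<and> is_foata \<Sigma> sim ser w)"

definition min_wrt :: "'a rel \<Rightarrow> 'a set \<Rightarrow> 'a" where
  "min_wrt le A = (THE m. m \<in> A \<and> (\<forall>x\<in>A. (m, x) \<in> le))"

definition step_le :: "'a set \<Rightarrow> 'a rel \<Rightarrow> 'a rel \<Rightarrow> 'a set rel" where
  "step_le \<Sigma> sim le =
     {(A, B). A \<in> steps \<Sigma> sim \<and> B \<in> steps \<Sigma> sim \<and>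
        (card A < card B \<or>
         card A = card B \<and> (A = B \<or> (min_wrt le (A - B), min_wrt le (B - A)) \<in> le))}"

text \<open>\<^const>\<open>lexord\<close> expects the strict part of the order on letters; it makes a proper
  prefix smaller.\<close>

definition seq_le :: "'a set \<Rightarrow> 'a rel \<Rightarrow> 'a rel \<Rightarrow> 'a set list rel" where
  "seq_le \<Sigma> sim le =
     {(u, v). u \<in> step_seqs \<Sigma> sim \<and> v \<in> step_seqs \<Sigma> sim \<and>
        (u = v \<or> (u, v) \<in> lexord (step_le \<Sigma> sim le - Id))}"

definition minlex :: "'a set \<Rightarrow> 'a rel \<Rightarrow> 'a rel \<Rightarrow> 'a set list set \<Rightarrow> 'a set list" where
  "minlex \<Sigma> sim le \<tau> = (THE w. w \<in> \<tau> \<and> (\<forall>v\<in>\<tau>. (w, v) \<in> seq_le \<Sigma> sim le))"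

end

theory Submission
  imports Defs
begin

text \<open>
  Deleting from a step sequence the first occurrence of every letter of a set \<open>S\<close> respects the
  comtrace congruence, which yields left cancellation. If \<open>A u\<close> and \<open>B v\<close> are congruent, then
  \<open>A \<times> (B - A) \<subseteq> ser\<close>, since for \<open>(a, b) \<notin> ser\<close> it is an invariant whether \<open>a\<close> first occurs
  strictly before \<open>b\<close>; deleting \<open>A\<close> from both sides gives \<open>u \<equiv> (B - A) x\<close>, so \<open>A \<union> B\<close> is again a
  first step of the comtrace. Hence every nonempty comtrace has an inclusion-greatest first step,
  which is also the step of strictly largest cardinality, and the Foata form, which always takes
  this step, is the greatest element. The least element exists because a comtrace is finite.
\<close>

text \<open>The argument \<open>S\<close> shrinks along the list, so later occurrences of a letter
  survive. A step contained in \<open>S\<close> is dropped, because keeping the empty set would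
  leave the step sequences.\<close>

fun delete_first :: "'a set \<Rightarrow> 'a set list \<Rightarrow> 'a set list" where
  "delete_first S [] = []"
| "delete_first S (X # w) =
     (if X \<subseteq> S then delete_first (S - X) w else (X - S) # delete_first (S - X) w)"

text \<open>The first occurrence of \<open>a\<close> precedes that of \<open>b\<close>, where \<open>b\<close> need not occur at all.\<close>

fun occurs_before :: "'a \<Rightarrow> 'a \<Rightarrow> 'a set list \<Rightarrow> bool" where
  "occurs_before a b [] \<longleftrightarrow> False"
| "occurs_before a b (X # w) \<longleftrightarrow> b \<notin> X \<and> (a \<in> X \<or> occurs_before a b w)"

lemma delete_first_empty: "{} \<notin> set w \<Longrightarrow> delete_first {} w = w"
  by (induction w) auto

lemma steps_subset: "A \<in> steps \<Sigma> sim \<Longrightarrow> B \<subseteq> A \<Longrightarrow> B \<noteq> {} \<Longrightarrow> B \<in> steps \<Sigma> sim"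
  unfolding steps_def by blast

lemma empty_not_in_step_seq: "w \<in> step_seqs \<Sigma> sim \<Longrightarrow> {} \<notin> set w"
  by (auto simp: steps_def)

lemma delete_first_step_seqs:
  "w \<in> step_seqs \<Sigma> sim \<Longrightarrow> delete_first S w \<in> step_seqs \<Sigma> sim"
proof (induction w arbitrary: S)
  case (Cons X w)
  then show ?case by (auto intro: steps_subset[of X])
qed simp

lemma lexord_total_on:
  assumes "total_on S r"
  shows "total_on (lists S) (lexord r)"
proof (rule total_onI)
  fix u v
  assume "u \<in> lists S" "v \<in> lists S" "u \<noteq> v"
  then show "(u, v) \<in> lexord r \<or> (v, u) \<in> lexord r"
  proof (induction u arbitrary: v)
    case Nil
    then show ?case by (cases v) auto
  next
    case (Cons a u)
    then show ?case using assms by (cases v) (auto simp: total_on_def)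
  qed
qed

context comtrace_alphabet
begin

section \<open>The comtrace congruence and its induction rules\<close>

abbreviation "step_set \<equiv> steps \<Sigma> sim"
abbreviation "rel \<equiv> comtrace_rel \<Sigma> sim ser"

abbreviation cong :: "'a set list \<Rightarrow> 'a set list \<Rightarrow> bool"  (infix \<open>\<approx>\<close> 50)
  where "u \<approx> v \<equiv> (u, v) \<in> comtrace_cong \<Sigma> sim ser"

lemma ser_disjoint: "A \<times> B \<subseteq> ser \<Longrightarrow> A \<inter> B = {}"
  using ser_sub_sim irrefl_sim by (fastforce simp: irrefl_def)

lemma union_step:
  assumes "A \<in> step_set" "B \<in> step_set" "A \<times> B \<subseteq> ser"
  shows "A \<union> B \<in> step_set"
proof -
  have "(a, b) \<in> sim \<and> (b, a) \<in> sim" if "a \<in> A" "b \<in> B" for a b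
    using that assms(3) ser_sub_sim sym_sim by (blast dest: symD)
  with assms(1,2) show ?thesis unfolding steps_def by blast
qed

lemma finite_steps: "finite step_set"
  by (rule finite_subset[of _ "Pow \<Sigma>"]) (auto simp: steps_def finite_alphabet)

lemma finite_step: "A \<in> step_set \<Longrightarrow> finite A"
  by (rule finite_subset[of _ \<Sigma>]) (auto simp: steps_def finite_alphabet)

text \<open>The prefix in front of the merged pair is peeled off one step at a time. This matches
  functions defined by recursion on the list, such as \<open>delete_first\<close> and
  \<open>occurs_before\<close>.\<close>

lemma rel_induct [consumes 1, case_names base Cons]:
  assumes "(w, w') \<in> rel"
    and base: "\<And>A B z. A \<in> step_set \<Longrightarrow> B \<in> step_set \<Longrightarrow> A \<times> B \<subseteq> ser \<Longrightarrow> z \<in> lists step_set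
      \<Longrightarrow> P (A # B # z) ((A \<union> B) # z)"
    and Cons: "\<And>X w w'. X \<in> step_set \<Longrightarrow> (w, w') \<in> rel \<Longrightarrow> P w w' \<Longrightarrow> P (X # w) (X # w')"
  shows "P w w'"
proof -
  obtain u A B z where eq: "w = u @ [A, B] @ z" "w' = u @ [A \<union> B] @ z"
    and u: "u \<in> lists step_set" and z: "z \<in> lists step_set"
    and AB: "A \<in> step_set" "B \<in> step_set" "A \<times> B \<subseteq> ser"
    using assms(1) unfolding comtrace_rel_def by blast
  from u have "P (u @ [A, B] @ z) (u @ [A \<union> B] @ z)"
  proof (induction u)
    case Nil
    then show ?case using base[OF AB z] by simp
  next
    case (Cons X u)
    have "(u @ [A, B] @ z, u @ [A \<union> B] @ z) \<in> rel"
      using Cons.hyps z AB unfolding comtrace_rel_def by blast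
    then show ?case using assms(3)[OF Cons.hyps(1) _ Cons.IH] by simp
  qed
  then show ?thesis using eq by simp
qed

lemma rel_merge:
  "A \<in> step_set \<Longrightarrow> B \<in> step_set \<Longrightarrow> A \<times> B \<subseteq> ser \<Longrightarrow> z \<in> lists step_set
    \<Longrightarrow> (A # B # z, (A \<union> B) # z) \<in> rel"
  unfolding comtrace_rel_def by (rule CollectI, rule exI[of _ "[]"]) auto

lemma rel_Cons:
  assumes "(w, w') \<in> rel" "X \<in> step_set"
  shows "(X # w, X # w') \<in> rel"
proof -
  obtain u A B z where "w = u @ [A, B] @ z" "w' = u @ [A \<union> B] @ z"
    and u: "u \<in> lists step_set" and "z \<in> lists step_set"
      "A \<in> step_set" "B \<in> step_set" "A \<times> B \<subseteq> ser"
    using assms(1) unfolding comtrace_rel_def by blast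
  moreover have "X # u \<in> lists step_set" using u assms(2) by simp
  ultimately show ?thesis
    unfolding comtrace_rel_def by (intro CollectI exI[of _ "X # u"]) auto
qed

lemma rel_step_seqs: "(w, w') \<in> rel \<Longrightarrow> w \<in> lists step_set \<and> w' \<in> lists step_set"
  by (induction rule: rel_induct) (auto intro: union_step)

lemma cong_step_seqs: "u \<approx> v \<Longrightarrow> u \<in> lists step_set" "u \<approx> v \<Longrightarrow> v \<in> lists step_set"
  unfolding comtrace_cong_def by auto

lemma cong_refl: "u \<in> lists step_set \<Longrightarrow> u \<approx> u"
  unfolding comtrace_cong_def by auto

lemma cong_trans: "u \<approx> v \<Longrightarrow> v \<approx> w \<Longrightarrow> u \<approx> w"
  unfolding comtrace_cong_def using rtrancl_trans by fast

lemma cong_sym: "u \<approx> v \<Longrightarrow> v \<approx> u"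
proof -
  have "sym ((rel \<union> rel\<inverse>)\<^sup>*)" by (intro sym_rtrancl sym_Un_converse)
  then show "u \<approx> v \<Longrightarrow> v \<approx> u" unfolding comtrace_cong_def by (auto dest: symD)
qed

lemma rel_imp_cong: "(u, v) \<in> rel \<Longrightarrow> u \<approx> v"
  using rel_step_seqs[of u v] unfolding comtrace_cong_def by auto

text \<open>For a property that is itself symmetric and transitive, the only case left with real
  content is a single merge.\<close>

lemma cong_induct [consumes 1, case_names refl rel sym trans]:
  assumes "u \<approx> v"
    and refl: "\<And>u. u \<in> lists step_set \<Longrightarrow> P u u"
    and rel: "\<And>u v. (u, v) \<in> rel \<Longrightarrow> P u v"
    and sym: "\<And>u v. P u v \<Longrightarrow> P v u"
    and trans: "\<And>u v w. P u v \<Longrightarrow> P v w \<Longrightarrow> P u w"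
  shows "P u v"
proof -
  have "(u, v) \<in> (rel \<union> rel\<inverse>)\<^sup>*" and u: "u \<in> lists step_set"
    using assms(1) unfolding comtrace_cong_def by auto
  then show ?thesis
  proof (induction rule: rtrancl_induct)
    case base
    then show ?case using refl by blast
  next
    case (step v w)
    then have "P v w" using rel sym by blast
    then show ?case using step trans by blast
  qed
qed

lemma cong_Cons: "u \<approx> v \<Longrightarrow> X \<in> step_set \<Longrightarrow> X # u \<approx> X # v"
proof (induction rule: cong_induct)
  case (refl u)
  then show ?case by (intro cong_refl) simp
next
  case (rel u v)
  then show ?case by (blast intro: rel_imp_cong rel_Cons)
next
  case (sym u v)
  then show ?case by (blast intro: cong_sym)
next
  case (trans u v w)
  then show ?case by (blast intro: cong_trans)
qed

section \<open>Deletion, cancellation and first steps\<close>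

lemma rel_delete_first:
  "(w, w') \<in> rel \<Longrightarrow> delete_first S w \<approx> delete_first S w'"
proof (induction arbitrary: S rule: rel_induct)
  case (base A B z)
  have disj: "A \<inter> B = {}" using ser_disjoint base(3) .
  let ?z = "delete_first (S - A - B) z"
  have z: "?z \<in> lists step_set" using base(4) by (rule delete_first_step_seqs)
  have rest: "S - (A \<union> B) = S - A - B" by blast
  \<comment> \<open>As \<open>A\<close> and \<open>B\<close> are disjoint, deleting in
    \<open>A\<close> first does not affect what is deleted in \<open>B\<close>. Hence if one of the
    two vanishes, both sides become equal; if both survive, what is left of them is still related by
    \<open>ser\<close> and can be merged.\<close>
  have B: "B - (S - A) = B - S" "B \<subseteq> S - A \<longleftrightarrow> B \<subseteq> S" using disj by blast+
  have diff: "A - S \<in> step_set" if "\<not> A \<subseteq> S" using that base(1) by (auto intro: steps_subset)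
  have diff': "B - S \<in> step_set" if "\<not> B \<subseteq> S" using that base(2) by (auto intro: steps_subset)
  consider "A \<subseteq> S" "B \<subseteq> S" | "A \<subseteq> S" "\<not> B \<subseteq> S" | "\<not> A \<subseteq> S" "B \<subseteq> S" | "\<not> A \<subseteq> S" "\<not> B \<subseteq> S"
    by blast
  then show ?case
  proof cases
    case 1
    then show ?thesis using z by (simp add: rest B cong_refl)
  next
    case 2
    then have "A \<union> B - S = B - S" by blast
    then show ?thesis using 2 z diff' by (simp add: rest B cong_refl)
  next
    case 3
    then have "A \<union> B - S = A - S" by blast
    then show ?thesis using 3 z diff by (simp add: rest B cong_refl)
  next
    case 4
    have "(A - S) # (B - S) # ?z \<approx> ((A - S) \<union> (B - S)) # ?z"
      using 4 base(3) z diff diff' by (intro rel_imp_cong rel_merge) auto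
    then show ?thesis using 4 by (simp add: rest B Un_Diff)
  qed
next
  case (Cons X w w')
  then show ?case by (auto intro!: cong_Cons intro: steps_subset)
qed

lemma cong_delete_first: "u \<approx> v \<Longrightarrow> delete_first S u \<approx> delete_first S v"
proof (induction rule: cong_induct)
  case (refl u)
  then show ?case by (intro cong_refl delete_first_step_seqs)
qed (blast intro: rel_delete_first cong_sym cong_trans)+

lemma delete_first_head: "u \<in> lists step_set \<Longrightarrow> delete_first A (A # u) = u"
  by (simp add: delete_first_empty[OF empty_not_in_step_seq])

lemma cong_cancel:
  assumes "A # u \<approx> A # v"
  shows "u \<approx> v"
proof -
  have "u \<in> lists step_set" "v \<in> lists step_set" using cong_step_seqs[OF assms] by auto
  then show ?thesis using cong_delete_first[OF assms, of A] by (metis delete_first_head)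
qed

text \<open>Merging \<open>A\<close> and \<open>B\<close> can change the truth value only if
  \<open>a \<in> A\<close> and \<open>b \<in> B\<close>: then \<open>a\<close> comes strictly first
  before the merge and not after it. But \<open>A \<times> B \<subseteq> ser\<close> would put
  \<open>(a, b)\<close> into \<open>ser\<close>.\<close>

lemma cong_occurs_before:
  assumes "u \<approx> v" and ab: "(a, b) \<notin> ser"
  shows "occurs_before a b u = occurs_before a b v"
  using assms(1)
proof (induction rule: cong_induct)
  case (rel u v)
  then show ?case using ab by (induction rule: rel_induct) auto
qed auto

text \<open>For \<open>a \<in> A\<close> and \<open>b \<in> B - A\<close>, the letter
  \<open>a\<close> occurs strictly before \<open>b\<close> in \<open>A # u\<close> but not in
  \<open>B # v\<close>, whose first step already contains \<open>b\<close>.\<close>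

lemma cong_heads_ser:
  assumes "A # u \<approx> B # v"
  shows "A \<times> (B - A) \<subseteq> ser"
proof (rule subrelI, rule ccontr)
  fix a b
  assume "(a, b) \<in> A \<times> (B - A)" "(a, b) \<notin> ser"
  then show False using cong_occurs_before[OF assms, of a b] by auto
qed

lemma cong_heads_union:
  assumes "A # u \<approx> B # v"
  shows "\<exists>x. (A \<union> B) # x \<approx> A # u"
proof (cases "B \<subseteq> A")
  case True
  then have "A \<union> B = A" by blast
  then show ?thesis using cong_step_seqs(1)[OF assms] cong_refl by metis
next
  case False
  \<comment> \<open>Deleting \<open>A\<close> from \<open>B # v\<close> leaves \<open>B - A\<close>
    followed by \<open>?x\<close>: once \<open>B\<close> has been passed, only the letters of
    \<open>A - B\<close> are still to be deleted.\<close>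
  let ?x = "delete_first (A - B) v"
  have steps: "A \<in> step_set" "u \<in> lists step_set" "B \<in> step_set" "v \<in> lists step_set"
    using cong_step_seqs[OF assms] by auto
  have "B - A \<in> step_set" using steps(3) False by (auto intro: steps_subset)
  moreover have "?x \<in> lists step_set" using steps(4) by (rule delete_first_step_seqs)
  ultimately have "A # (B - A) # ?x \<approx> (A \<union> (B - A)) # ?x"
    using steps(1) cong_heads_ser[OF assms] by (intro rel_imp_cong rel_merge)
  moreover have "u \<approx> (B - A) # ?x"
    using cong_delete_first[OF assms, of A] False delete_first_head[OF steps(2), of A] by simp
  then have "A # u \<approx> A # (B - A) # ?x" using steps(1) by (rule cong_Cons)
  ultimately show ?thesis by (metis Un_Diff_cancel cong_sym cong_trans)
qed

section \<open>Weight, finiteness and the greatest first step\<close>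

lemma cong_weight: "u \<approx> v \<Longrightarrow> sum_list (map card u) = sum_list (map card v)"
proof (induction rule: cong_induct)
  case (rel u v)
  then show ?case
  proof (induction rule: rel_induct)
    case (base A B z)
    \<comment> \<open>Merged steps are disjoint, so a merge preserves the total number of letter
      occurrences.\<close>
    then show ?case using ser_disjoint[of A B] by (simp add: card_Un_disjoint finite_step)
  qed simp
qed auto

lemma length_le_weight: "w \<in> lists step_set \<Longrightarrow> length w \<le> sum_list (map card w)"
proof (induction w)
  case (Cons X w)
  then have "card X > 0" by (simp add: card_gt_0_iff finite_step) (simp add: steps_def)
  then show ?case using Cons by simp
qed simp

lemma cong_Nil: "u \<approx> [] \<Longrightarrow> u = []"
  using cong_weight[of u "[]"] length_le_weight[of u] cong_step_seqs(1)[of u "[]"]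
  by (simp del: sum_list_eq_0_iff)

text \<open>Steps are nonempty, so the common weight bounds the length of every member, and there
  are only finitely many steps.\<close>

lemma finite_cong_class: "finite {v. v \<approx> w}"
proof (rule finite_subset)
  show "{v. v \<approx> w} \<subseteq> {v. set v \<subseteq> step_set \<and> length v \<le> sum_list (map card w)}"
    using cong_weight length_le_weight cong_step_seqs(1) by fastforce
qed (rule finite_lists_length_le[OF finite_steps])

text \<open>The first steps of a comtrace form a finite nonempty family closed under binary unions,
  so a maximal member contains all the others.\<close>

lemma greatest_first_step:
  assumes "w \<in> lists step_set" "w \<noteq> []"
  obtains A v where "A # v \<approx> w" "\<And>B u. B # u \<approx> w \<Longrightarrow> B \<subseteq> A"
proof -
  let ?F = "{A. \<exists>v. A # v \<approx> w}"
  have "?F \<subseteq> step_set" using cong_step_seqs(1) by fastforce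
  then have "finite ?F" using finite_steps by (rule finite_subset)
  moreover have "?F \<noteq> {}"
    using assms cong_refl[of w] by (cases w) auto
  ultimately obtain A where A: "A \<in> ?F" and max: "\<And>B. B \<in> ?F \<Longrightarrow> A \<subseteq> B \<Longrightarrow> B = A"
    using finite_has_maximal[of ?F] by blast
  then obtain v where v: "A # v \<approx> w" by blast
  have "B \<subseteq> A" if "B # u \<approx> w" for B u
  proof -
    have "A # v \<approx> B # u" using v that cong_sym cong_trans by blast
    then obtain x where "(A \<union> B) # x \<approx> A # v" using cong_heads_union by blast
    then have "A \<union> B \<in> ?F" using v cong_trans by blast
    then show ?thesis using max[of "A \<union> B"] by blast
  qed
  then show ?thesis using that v by blast
qed

section \<open>The Foata canonical form\<close>

lemma is_foata_Cons:
  "is_foata \<Sigma> sim ser (A # f) \<longleftrightarrow>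
     A \<in> step_set \<and> is_foata \<Sigma> sim ser f \<and> (\<forall>B u. B # u \<approx> A # f \<longrightarrow> B \<subseteq> A)"
proof -
  have step: "B \<in> step_set \<and> u \<in> lists step_set" if "B # u \<approx> v" for B u v
    using cong_step_seqs(1)[OF that] by simp
  \<comment> \<open>Congruence already forces \<open>B\<close> and \<open>u\<close> to consist of
    steps, so the quantifiers may be unbounded. Splitting off the index 0 then separates the
    condition on the head from the Foata condition on the tail.\<close>
  have foata_iff: "is_foata \<Sigma> sim ser w \<longleftrightarrow> w \<in> lists step_set \<and>
      (\<forall>i<length w. \<forall>B u. B # u \<approx> drop i w \<longrightarrow> B \<subseteq> w ! i)" for w
    unfolding is_foata_def using step by blast
  show ?thesis
    unfolding foata_iff length_Cons All_less_Suc2 by auto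
qed

text \<open>Greedy construction: take the greatest first step and continue with the remainder. The
  induction is on the weight, since the remainder \<open>v\<close> comes from a congruent sequence
  and its length is not controlled by that of \<open>w\<close>. Maximality of the head carries over
  from \<open>w\<close> to \<open>A # f\<close> by transitivity.\<close>

lemma foata_exists:
  assumes "w \<in> lists step_set"
  shows "\<exists>f. f \<approx> w \<and> is_foata \<Sigma> sim ser f"
  using assms
proof (induction "sum_list (map card w)" arbitrary: w rule: less_induct)
  case less
  show ?case
  proof (cases "w = []")
    case True
    then show ?thesis using cong_refl[of "[]"] by (auto simp: is_foata_def)
  next
    case False
    obtain A v where v: "A # v \<approx> w" and max: "\<And>B u. B # u \<approx> w \<Longrightarrow> B \<subseteq> A"
      using greatest_first_step[OF less.prems False] by metis
    have A: "A \<in> step_set" "v \<in> lists step_set" using cong_step_seqs(1)[OF v] by auto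
    then have "card A > 0" by (simp add: card_gt_0_iff finite_step) (simp add: steps_def)
    then have "sum_list (map card v) < sum_list (map card w)" using cong_weight[OF v] by simp
    then obtain f where f: "f \<approx> v" "is_foata \<Sigma> sim ser f" using less.hyps A(2) by blast
    have "A # f \<approx> w" using cong_trans[OF cong_Cons[OF f(1) A(1)] v] .
    moreover from this have "is_foata \<Sigma> sim ser (A # f)"
      using A(1) f(2) max cong_trans unfolding is_foata_Cons by blast
    ultimately show ?thesis by blast
  qed
qed

text \<open>Each head is a first step of the same comtrace, so the heads contain each other;
  cancelling them leaves congruent Foata tails.\<close>

lemma foata_unique:
  "f \<approx> g \<Longrightarrow> is_foata \<Sigma> sim ser f \<Longrightarrow> is_foata \<Sigma> sim ser g \<Longrightarrow> f = g"
proof (induction f arbitrary: g)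
  case Nil
  then show ?case using cong_Nil cong_sym by blast
next
  case (Cons A f)
  show ?case
  proof (cases g)
    case Nil
    then show ?thesis using Cons.prems cong_Nil by blast
  next
    case (Cons B h)
    have "A = B"
      using Cons.prems cong_sym unfolding Cons is_foata_Cons by blast
    then show ?thesis
      using Cons.prems Cons.IH[of h] cong_cancel unfolding Cons is_foata_Cons by blast
  qed
qed

text \<open>Equal heads cancel, so up to the first difference the remainders stay congruent. There
  the step of \<open>w\<close> is a proper subset of that of \<open>f\<close>, and cardinality alone
  decides the comparison.\<close>

lemma seq_le_foata:
  "is_foata \<Sigma> sim ser f \<Longrightarrow> w \<approx> f \<Longrightarrow> (w, f) \<in> seq_le \<Sigma> sim le"
proof (induction f arbitrary: w)
  case Nil
  then have "w = []" by (intro cong_Nil)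
  then show ?case by (simp add: seq_le_def)
next
  case (Cons A f)
  note steps = cong_step_seqs[OF Cons.prems(2)]
  show ?case
  proof (cases w)
    case Nil
    then show ?thesis using steps by (simp add: seq_le_def)
  next
    case (Cons B u)
    have sub: "B \<subseteq> A" using Cons.prems unfolding Cons is_foata_Cons by blast
    show ?thesis
    proof (cases "B = A")
      case True
      then have "u \<approx> f" using Cons.prems(2) cong_cancel unfolding Cons by blast
      then have "(u, f) \<in> seq_le \<Sigma> sim le"
        using Cons.prems(1) Cons.IH unfolding is_foata_Cons by blast
      then show ?thesis using steps True Cons by (auto simp: seq_le_def)
    next
      case False
      have "finite A" using steps(2) finite_step by simp
      then have "card B < card A" using sub False by (intro psubset_card_mono) auto
      then have "(B, A) \<in> step_le \<Sigma> sim le - Id" using steps Cons by (auto simp: step_le_def)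
      then show ?thesis using steps Cons by (simp add: seq_le_def)
    qed
  qed
qed

section \<open>The order on steps\<close>

lemma min_wrt_least:
  assumes "linear_order_on \<Sigma> le" "A \<subseteq> \<Sigma>" "A \<noteq> {}"
  shows "min_wrt le A \<in> A" "\<And>x. x \<in> A \<Longrightarrow> (min_wrt le A, x) \<in> le"
proof -
  have le: "refl_on \<Sigma> le" "trans le" "antisym le" "total_on \<Sigma> le"
    using assms(1) by (auto simp: linear_order_on_def partial_order_on_def preorder_on_def)
  have "finite A" using assms(2) finite_alphabet by (rule finite_subset)
  then have "\<exists>m\<in>A. \<forall>x\<in>A. (m, x) \<in> le" using assms(3,2)
  proof (induction rule: finite_ne_induct)
    case (singleton x)
    then show ?case using le(1) by (auto dest: refl_onD)
  next
    case (insert y F)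
    then obtain m where m: "m \<in> F" "\<forall>x\<in>F. (m, x) \<in> le" by auto
    have refl: "(y, y) \<in> le" using insert.prems le(1) by (auto dest: refl_onD)
    have "m \<in> \<Sigma>" "y \<in> \<Sigma>" "m \<noteq> y" using insert m(1) by auto
    then consider "(m, y) \<in> le" | "(y, m) \<in> le" using le(4) by (auto simp: total_on_def)
    then show ?case
    proof cases
      case 1
      then show ?thesis using m by blast
    next
      case 2
      then have "\<forall>x\<in>F. (y, x) \<in> le" using m(2) 2 by (blast intro: transD[OF le(2)])
      then show ?thesis using refl by blast
    qed
  qed
  then have "\<exists>!m. m \<in> A \<and> (\<forall>x\<in>A. (m, x) \<in> le)" using le(3) by (auto dest: antisymD)
  then have "min_wrt le A \<in> A \<and> (\<forall>x\<in>A. (min_wrt le A, x) \<in> le)"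
    unfolding min_wrt_def by (rule theI')
  then show "min_wrt le A \<in> A" "\<And>x. x \<in> A \<Longrightarrow> (min_wrt le A, x) \<in> le" by auto
qed

text \<open>For distinct steps of equal size the order says that the least letter in which they differ
  belongs to the smaller one. In this form transitivity becomes evident.\<close>

lemma step_less_iff:
  assumes lin: "linear_order_on \<Sigma> le"
  shows "(A, B) \<in> step_le \<Sigma> sim le - Id \<longleftrightarrow>
    A \<in> step_set \<and> B \<in> step_set \<and>
    (card A < card B \<or> card A = card B \<and>
      (\<exists>m\<in>A - B. \<forall>x. (x, m) \<in> le \<longrightarrow> x \<noteq> m \<longrightarrow> (x \<in> A \<longleftrightarrow> x \<in> B)))"
proof (cases "A \<in> step_set \<and> B \<in> step_set \<and> card A = card B \<and> A \<noteq> B")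
  case True
  have le: "trans le" "antisym le" "total_on \<Sigma> le"
    using lin by (auto simp: linear_order_on_def partial_order_on_def preorder_on_def)
  have fin: "finite A" "finite B" using True finite_step by auto
  \<comment> \<open>Distinct finite sets of equal size do not contain one another, so both minima
    are taken over nonempty sets.\<close>
  have ne: "A - B \<noteq> {}" "B - A \<noteq> {}"
    using True fin card_subset_eq[of A B] card_subset_eq[of B A] by auto
  have sub: "A - B \<subseteq> \<Sigma>" "B - A \<subseteq> \<Sigma>" using True by (auto simp: steps_def)
  let ?a = "min_wrt le (A - B)" and ?b = "min_wrt le (B - A)"
  note a = min_wrt_least[OF lin sub(1) ne(1)] and b = min_wrt_least[OF lin sub(2) ne(2)]
  have "(?a, ?b) \<in> le \<longleftrightarrow> (\<exists>m\<in>A - B. \<forall>x. (x, m) \<in> le \<longrightarrow> x \<noteq> m \<longrightarrow> (x \<in> A \<longleftrightarrow> x \<in> B))"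
  proof
    assume ab: "(?a, ?b) \<in> le"
    have "x \<in> A \<longleftrightarrow> x \<in> B" if x: "(x, ?a) \<in> le" "x \<noteq> ?a" for x
    proof -
      \<comment> \<open>A letter \<open>x\<close> of \<open>A - B\<close> would satisfy
        \<open>(?a, x) \<in> le\<close> by minimality, and one of \<open>B - A\<close> would satisfy
        it through \<open>?b\<close>. So \<open>x\<close> lies in both sets or in neither.\<close>
      have "(?a, x) \<notin> le" using x antisymD[OF le(2)] by blast
      then show ?thesis using a(2)[of x] b(2)[of x] transD[OF le(1) ab, of x] by blast
    qed
    then show "\<exists>m\<in>A - B. \<forall>x. (x, m) \<in> le \<longrightarrow> x \<noteq> m \<longrightarrow> (x \<in> A \<longleftrightarrow> x \<in> B)"
      using a(1) by blast
  next
    assume "\<exists>m\<in>A - B. \<forall>x. (x, m) \<in> le \<longrightarrow> x \<noteq> m \<longrightarrow> (x \<in> A \<longleftrightarrow> x \<in> B)"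
    then obtain m where m: "m \<in> A - B" "\<And>x. (x, m) \<in> le \<Longrightarrow> x \<noteq> m \<Longrightarrow> x \<in> A \<longleftrightarrow> x \<in> B" by blast
    have "?b \<noteq> m" using m(1) b(1) by blast
    \<comment> \<open>The letter \<open>?b\<close> distinguishes \<open>A\<close> from
      \<open>B\<close>, whereas the letters strictly below \<open>m\<close> do not.\<close>
    moreover have "(?b, m) \<notin> le" using m(2)[of ?b] b(1) calculation by blast
    ultimately have "(m, ?b) \<in> le" using le(3) m(1) b(1) sub by (auto simp: total_on_def)
    then show "(?a, ?b) \<in> le" using transD[OF le(1) a(2)[OF m(1)]] by blast
  qed
  then show ?thesis using True by (simp add: step_le_def)
next
  \<comment> \<open>If \<open>A = B\<close>, there is no \<open>m\<close> in \<open>A - B\<close>;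
    in the other cases both sides are false or are decided by the cardinalities.\<close>
  case False
  then show ?thesis by (auto simp: step_le_def)
qed

lemma step_less_order:
  assumes lin: "linear_order_on \<Sigma> le"
  defines "r \<equiv> step_le \<Sigma> sim le - Id"
  shows "trans r" and "total_on step_set r" and "irrefl r"
proof -
  have le: "trans le" "antisym le" "total_on \<Sigma> le"
    using lin by (auto simp: linear_order_on_def partial_order_on_def preorder_on_def)
  show "trans r"
  proof (rule transI)
    fix A B C
    assume AB: "(A, B) \<in> r" and BC: "(B, C) \<in> r"
    note AB' = AB[unfolded r_def step_less_iff[OF lin]]
      and BC' = BC[unfolded r_def step_less_iff[OF lin]]
    show "(A, C) \<in> r"
    proof (cases "card A = card B \<and> card B = card C")
      case False
      then show ?thesis using AB' BC' unfolding r_def step_less_iff[OF lin] by auto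
    next
      case True
      then obtain m n
        where m: "m \<in> A - B" "\<And>x. (x, m) \<in> le \<Longrightarrow> x \<noteq> m \<Longrightarrow> x \<in> A \<longleftrightarrow> x \<in> B"
          and n: "n \<in> B - C" "\<And>x. (x, n) \<in> le \<Longrightarrow> x \<noteq> n \<Longrightarrow> x \<in> B \<longleftrightarrow> x \<in> C"
        using AB' BC' by auto
      have "m \<noteq> n" using m(1) n(1) by blast
      moreover have "m \<in> \<Sigma>" "n \<in> \<Sigma>" using m(1) n(1) AB' by (auto simp: steps_def)
      ultimately consider "(m, n) \<in> le" | "(n, m) \<in> le" using le(3) by (auto simp: total_on_def)
      \<comment> \<open>The witness is the smaller of \<open>m\<close> and \<open>n\<close>:
        strictly below it, \<open>A\<close> agrees with \<open>B\<close> and \<open>B\<close> with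
        \<open>C\<close>.\<close>
      then have "\<exists>k\<in>A - C. \<forall>x. (x, k) \<in> le \<longrightarrow> x \<noteq> k \<longrightarrow> (x \<in> A \<longleftrightarrow> x \<in> C)"
      proof cases
        case 1
        have "m \<in> A - C" using m(1) n(2)[OF 1 \<open>m \<noteq> n\<close>] by blast
        moreover have "x \<in> A \<longleftrightarrow> x \<in> C" if "(x, m) \<in> le" "x \<noteq> m" for x
        proof -
          have "(x, n) \<in> le" using transD[OF le(1) that(1) 1] .
          moreover have "x \<noteq> n" using that 1 antisymD[OF le(2)] by blast
          ultimately show ?thesis using m(2)[OF that] n(2) by blast
        qed
        ultimately show ?thesis by blast
      next
        case 2
        have "n \<in> A - C" using n(1) m(2)[OF 2] \<open>m \<noteq> n\<close> by blast
        moreover have "x \<in> A \<longleftrightarrow> x \<in> C" if "(x, n) \<in> le" "x \<noteq> n" for x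
        proof -
          have "(x, m) \<in> le" using transD[OF le(1) that(1) 2] .
          moreover have "x \<noteq> m" using that 2 antisymD[OF le(2)] by blast
          ultimately show ?thesis using n(2)[OF that] m(2) by blast
        qed
        ultimately show ?thesis by blast
      qed
      then show ?thesis using AB' BC' True unfolding r_def step_less_iff[OF lin] by auto
    qed
  qed
  show "total_on step_set r"
  proof (rule total_onI)
    fix A B
    assume AB: "A \<in> step_set" "B \<in> step_set" "A \<noteq> B"
    show "(A, B) \<in> r \<or> (B, A) \<in> r"
    proof (cases "card A = card B")
      case True
      have "finite A" "finite B" using AB finite_step by auto
      then have ne: "A - B \<noteq> {}" "B - A \<noteq> {}"
        using True AB(3) card_subset_eq[of A B] card_subset_eq[of B A] by auto
      have sub: "A - B \<subseteq> \<Sigma>" "B - A \<subseteq> \<Sigma>" using AB by (auto simp: steps_def)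
      have in_diff: "min_wrt le (A - B) \<in> A - B" "min_wrt le (B - A) \<in> B - A"
        using min_wrt_least(1)[OF lin] sub ne by blast+
      then have "min_wrt le (A - B) \<noteq> min_wrt le (B - A)" by auto
      then have "(min_wrt le (A - B), min_wrt le (B - A)) \<in> le \<or>
        (min_wrt le (B - A), min_wrt le (A - B)) \<in> le"
        using le(3) in_diff sub by (auto simp: total_on_def)
      then show ?thesis using AB True by (auto simp: r_def step_le_def)
    qed (use AB in \<open>auto simp: r_def step_le_def\<close>)
  qed
  show "irrefl r" by (auto simp: r_def irrefl_def)
qed

section \<open>The order on step sequences and its extremal elements\<close>

lemma seq_le_linear:
  assumes "linear_order_on \<Sigma> le"
  shows "trans (seq_le \<Sigma> sim le)" "antisym (seq_le \<Sigma> sim le)"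
    and "u \<in> lists step_set \<Longrightarrow> v \<in> lists step_set
      \<Longrightarrow> (u, v) \<in> seq_le \<Sigma> sim le \<or> (v, u) \<in> seq_le \<Sigma> sim le"
proof -
  let ?r = "step_le \<Sigma> sim le - Id"
  note r = step_less_order[OF assms]
  have trans: "trans (lexord ?r)" using r(1) by (rule lexord_transI)
  have irrefl: "(x, x) \<notin> lexord ?r" for x
    using r(3) by (intro lexord_irreflexive) auto
  show "trans (seq_le \<Sigma> sim le)"
    by (rule transI) (auto simp: seq_le_def intro: transD[OF trans])
  \<comment> \<open>Two distinct sequences below each other would, by transitivity, put a sequence
    strictly below itself.\<close>
  show "antisym (seq_le \<Sigma> sim le)"
    using transD[OF trans] irrefl by (intro antisymI) (auto simp: seq_le_def)
  show "u \<in> lists step_set \<Longrightarrow> v \<in> lists step_set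
      \<Longrightarrow> (u, v) \<in> seq_le \<Sigma> sim le \<or> (v, u) \<in> seq_le \<Sigma> sim le"
    using lexord_total_on[OF r(2)] by (auto simp: seq_le_def total_on_def)
qed

lemma seq_le_least_exists:
  assumes lin: "linear_order_on \<Sigma> le"
    and "finite T" "T \<noteq> {}" "T \<subseteq> lists step_set"
  shows "\<exists>m\<in>T. \<forall>v\<in>T. (m, v) \<in> seq_le \<Sigma> sim le"
  using assms(2-)
proof (induction rule: finite_ne_induct)
  case (singleton x)
  then show ?case by (simp add: seq_le_def)
next
  case (insert x F)
  then obtain m where m: "m \<in> F" "\<forall>v\<in>F. (m, v) \<in> seq_le \<Sigma> sim le" by auto
  have refl: "(x, x) \<in> seq_le \<Sigma> sim le" using insert.prems by (simp add: seq_le_def)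
  have "m \<in> lists step_set" "x \<in> lists step_set" using insert.prems m(1) by auto
  then consider "(m, x) \<in> seq_le \<Sigma> sim le" | "(x, m) \<in> seq_le \<Sigma> sim le"
    using seq_le_linear(3)[OF lin] by blast
  then show ?case
  proof cases
    case 1
    then show ?thesis using m by blast
  next
    case 2
    then have "\<forall>v\<in>F. (x, v) \<in> seq_le \<Sigma> sim le"
      using m(2) by (blast intro: transD[OF seq_le_linear(1)[OF lin]])
    then show ?thesis using refl by blast
  qed
qed

lemma minlex_least:
  assumes lin: "linear_order_on \<Sigma> le"
    and "finite T" "T \<noteq> {}" "T \<subseteq> lists step_set"
  shows "minlex \<Sigma> sim le T \<in> T \<and> (\<forall>v\<in>T. (minlex \<Sigma> sim le T, v) \<in> seq_le \<Sigma> sim le)"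
proof -
  have "\<exists>!m. m \<in> T \<and> (\<forall>v\<in>T. (m, v) \<in> seq_le \<Sigma> sim le)"
    using seq_le_least_exists[OF assms] seq_le_linear(2)[OF lin] by (auto dest: antisymD)
  then show ?thesis unfolding minlex_def by (rule theI')
qed

lemma foata_form_greatest:
  assumes "w \<in> lists step_set"
  defines "T \<equiv> {v. v \<approx> w}"
  shows "foata_form \<Sigma> sim ser T \<in> T \<and> (\<forall>v\<in>T. (v, foata_form \<Sigma> sim ser T) \<in> seq_le \<Sigma> sim le)"
proof -
  have cong: "u \<approx> v" if "u \<in> T" "v \<in> T" for u v
    using that cong_sym cong_trans unfolding T_def by blast
  have "\<exists>!f. f \<in> T \<and> is_foata \<Sigma> sim ser f"
    using foata_exists[OF assms(1)] foata_unique cong unfolding T_def by blast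
  then have "foata_form \<Sigma> sim ser T \<in> T \<and> is_foata \<Sigma> sim ser (foata_form \<Sigma> sim ser T)"
    unfolding foata_form_def by (rule theI')
  then show ?thesis using seq_le_foata cong by blast
qed

end

theorem theorem3p1:
  fixes \<Sigma> :: "'a set" and sim ser le :: "'a rel" and \<tau> :: "'a set list set"
  assumes "comtrace_alphabet \<Sigma> sim ser"
    and "linear_order_on \<Sigma> le"
    and "\<tau> \<in> comtraces \<Sigma> sim ser"
  shows "(foata_form \<Sigma> sim ser \<tau> \<in> \<tau> \<and>
          (\<forall>w\<in>\<tau>. (w, foata_form \<Sigma> sim ser \<tau>) \<in> seq_le \<Sigma> sim le)) \<and>
         (minlex \<Sigma> sim le \<tau> \<in> \<tau> \<and>
          (\<forall>w\<in>\<tau>. (minlex \<Sigma> sim le \<tau>, w) \<in> seq_le \<Sigma> sim le))"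
proof -
  interpret comtrace_alphabet \<Sigma> sim ser by fact
  obtain w where w: "w \<in> lists step_set" "\<tau> = comtrace_cong \<Sigma> sim ser `` {w}"
    using assms(3) unfolding comtraces_def by (rule quotientE)
  \<comment> \<open>The quotient presents the class as all \<open>v\<close> with
    \<open>w \<approx> v\<close>; symmetry reverses the pairs into the form used for finiteness and
    for the Foata form.\<close>
  have \<tau>: "\<tau> = {v. v \<approx> w}" using w(2) cong_sym by blast
  have "finite \<tau>" "\<tau> \<noteq> {}" "\<tau> \<subseteq> lists step_set"
    using finite_cong_class cong_refl[OF w(1)] cong_step_seqs(1) unfolding \<tau> by blast+
  from minlex_least[OF assms(2) this] show ?thesis
    using foata_form_greatest[OF w(1)] unfolding \<tau> by blast
qed

end
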